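(* Let $K>0$ and $\theta\in(-\pi/4,\pi/4]$ with $Ke^{i\theta}\in U$. If $\theta=0$, then $$\mathcal{M}_{K,0}\cap\mathbb{R}=\left[-\frac{2}{K^2},\frac{1}{4K^2}\right].$$ If $\theta\neq0$, then there exist an angle $\phi_0\in[0,2\pi]$ and a real number $\eta>0$ such that the line segment $\{te^{i\phi_0}: t\in[-\frac{2}{\eta},\frac{1}{4\eta}]\}$ is contained in $\mathcal{M}_{K,\theta}$.
   Context: For $K>0$ and $\theta\in\mathbb{R}$, $h_{K,\theta}:\mathbb{C}\to\mathbb{C}$ is the affine stretch $h_{K,\theta}(z)=\left(\frac{K+1}{2}\right)z+e^{2i\theta}\left(\frac{K-1}{2}\right)\overline{z}$. The set $U$ is $$U=\{0<|z|<1,\ -\pi/4<\arg(z)\le \pi/4\}\cup\{|z|>1,\ -\pi/4<\arg(z)\le\pi/4\}\cup\{1\}\subset\mathbb{C}.$$ For $Ke^{i\theta}\in U$ and $c\in\mathbb{C}$ let $f_c=g_c\circ h_{K,\theta}$, where $g_c(z)=z^2+c$. The escaping set of $f:\mathbb{C}\to\mathbb{C}$ is $I(f)=\{z\in\mathbb{C}: f^{n}(z)\to\infty\}$, where $f^n$ is the $n$-th iterate. The $(K,\theta)$-Mandelbrot set $\mathcal{M}_{K,\theta}$ is the set of those $c\in\mathbb{C}$ for which $0\notin I(f_c)$. *)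

theory Defs
  imports Complex_Main
begin

definition stretch :: "real \<Rightarrow> real \<Rightarrow> complex \<Rightarrow> complex" where
  "stretch K \<theta> z =
     of_real ((K + 1) / 2) * z + exp (2 * \<i> * of_real \<theta>) * of_real ((K - 1) / 2) * cnj z"

definition quad :: "complex \<Rightarrow> complex \<Rightarrow> complex" where
  "quad c z = z\<^sup>2 + c"

definition qr_quad :: "real \<Rightarrow> real \<Rightarrow> complex \<Rightarrow> complex \<Rightarrow> complex" where
  "qr_quad K \<theta> c = quad c \<circ> stretch K \<theta>"

text \<open>Points \<open>K e\<^sup>i\<^sup>\<theta>\<close> encode the pairs \<open>(K, \<theta>)\<close>. On the unit circle the stretch is the
  identity whatever the angle, so only the point \<open>1\<close> is kept there.\<close>

definition param_set :: "complex set" where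
  "param_set =
     {z. 0 < norm z \<and> norm z < 1 \<and> - pi / 4 < Arg z \<and> Arg z \<le> pi / 4} \<union>
     {z. norm z > 1 \<and> - pi / 4 < Arg z \<and> Arg z \<le> pi / 4} \<union> {1}"

definition escaping_set :: "(complex \<Rightarrow> complex) \<Rightarrow> complex set" where
  "escaping_set f = {z. filterlim (\<lambda>n. (f ^^ n) z) at_infinity sequentially}"

definition mandelbrot :: "real \<Rightarrow> real \<Rightarrow> complex set" where
  "mandelbrot K \<theta> = {c. 0 \<notin> escaping_set (qr_quad K \<theta> c)}"

end

theory Submission imports Defs begin

text \<open>
  Everything happens on an invariant line. Let \<open>u\<close> be a unit vector whose image under the stretch
  \<open>h\<close> satisfies \<open>(h u)\<^sup>2 = \<eta> u\<close> with \<open>\<eta> > 0\<close>. As \<open>h\<close> is real-linear, \<open>f\<^sub>c\<close> with \<open>c = t u\<close> maps the line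
  \<open>\<real> u\<close> to itself by \<open>x u \<mapsto> (\<eta> x\<^sup>2 + t) u\<close>, and rescaling by \<open>\<eta>\<close> turns this into the real quadratic
  map \<open>y \<mapsto> y\<^sup>2 + \<eta> t\<close>. The critical orbit of \<open>y \<mapsto> y\<^sup>2 + s\<close> escapes exactly when \<open>s \<notin> [-2, 1/4]\<close>,
  hence \<open>t u\<close> lies in the Mandelbrot set if and only if \<open>-2/\<eta> \<le> t \<le> 1/(4\<eta>)\<close>
  (\<open>invariant_line_mandelbrot_iff\<close>).

  For \<open>\<theta> = 0\<close> the vector \<open>u = 1\<close> qualifies with \<open>\<eta> = K\<^sup>2\<close>, which describes the whole real slice. For
  general \<open>\<theta>\<close> a suitable \<open>u\<close> comes from the intermediate value theorem
  (\<open>stretch_invariant_direction\<close>).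
\<close>

lemma increasing_by_at_least_tends_to_infinity:
  fixes y :: "nat \<Rightarrow> real"
  assumes "d > 0" and step: "\<And>n. y n + d \<le> y (Suc n)"
  shows "filterlim y at_top sequentially"
proof (rule filterlim_at_top_mono)
  have "y 0 + real n * d \<le> y n" for n
  proof (induction n)
    case (Suc n)
    then show ?case using step[of n] by (simp add: algebra_simps)
  qed simp
  then show "\<forall>\<^sub>F n in sequentially. y 0 + real n * d \<le> y n" by simp
  show "filterlim (\<lambda>n. y 0 + real n * d) at_top sequentially"
    using \<open>d > 0\<close>
    by (intro filterlim_tendsto_add_at_top[OF tendsto_const]
        filterlim_at_top_mult_tendsto_pos[OF tendsto_const] filterlim_real_sequentially)
qed

abbreviation critical_orbit :: "real \<Rightarrow> nat \<Rightarrow> real" where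
  "critical_orbit s n \<equiv> ((\<lambda>y. y\<^sup>2 + s) ^^ n) 0"

text \<open>For \<open>0 \<le> s \<le> 1/4\<close> the interval \<open>[0, 1/2]\<close> is invariant. For \<open>-2 \<le> s < 0\<close> the interval
  \<open>[s, -s]\<close> is, because \<open>s\<^sup>2 + s \<le> -s\<close> amounts to \<open>s (s + 2) \<le> 0\<close>.\<close>

lemma critical_orbit_bounded:
  assumes "-2 \<le> s" "s \<le> 1/4"
  shows "\<bar>critical_orbit s n\<bar> \<le> 2"
proof (cases "s \<ge> 0")
  case True
  have "0 \<le> critical_orbit s n \<and> critical_orbit s n \<le> 1/2"
  proof (induction n)
    case (Suc n)
    then have "(critical_orbit s n)\<^sup>2 \<le> (1/2)\<^sup>2" by (intro power_mono) auto
    then show ?case using assms True by (simp add: power2_eq_square)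
  qed simp
  then show ?thesis by simp
next
  case False
  have "\<bar>critical_orbit s n\<bar> \<le> - s"
  proof (induction n)
    case (Suc n)
    then have "(critical_orbit s n)\<^sup>2 \<le> s\<^sup>2"
      by (metis abs_le_square_iff abs_minus_cancel abs_ge_self order_trans)
    moreover have "s * (s + 2) \<le> 0"
      using assms False by (intro mult_nonpos_nonneg) auto
    ultimately show ?case by (simp add: power2_eq_square algebra_simps abs_le_iff)
  qed (use False in simp)
  then show ?thesis using assms by linarith
qed

text \<open>Each step satisfies \<open>y\<^sup>2 + s - y = (y - 1/2)\<^sup>2 + (s - 1/4)\<close>, so for \<open>s > 1/4\<close> the orbit grows by at
  least \<open>s - 1/4\<close> per step. For \<open>s < -2\<close> the second iterate already exceeds \<open>-s > 2\<close>, and on \<open>y \<ge> -s\<close> one has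
  \<open>y\<^sup>2 + s - y \<ge> y (y - 2) \<ge> -s (-s - 2) > 0\<close>.\<close>

lemma critical_orbit_escapes:
  assumes "s < -2 \<or> 1/4 < s"
  shows "filterlim (critical_orbit s) at_top sequentially"
  using assms
proof
  assume s: "1/4 < s"
  show ?thesis
  proof (rule increasing_by_at_least_tends_to_infinity[of "s - 1/4"])
    fix n
    have "(critical_orbit s n - 1/2)\<^sup>2 \<ge> 0" by simp
    then show "critical_orbit s n + (s - 1/4) \<le> critical_orbit s (Suc n)"
      by (simp add: power2_eq_square algebra_simps)
  qed (use s in simp)
next
  assume s: "s < -2"
  define a where "a = - s"
  have a: "a > 2" using s by (simp add: a_def)
  have step: "y + a * (a - 2) \<le> y\<^sup>2 + s" if "a \<le> y" for y
  proof -
    have "a * (a - 2) \<le> y * (y - 2)" using a that by (intro mult_mono) auto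
    then show ?thesis using that by (simp add: a_def power2_eq_square algebra_simps)
  qed
  have d: "a * (a - 2) > 0" using a by simp
  have large: "a \<le> critical_orbit s (n + 2)" for n
  proof (induction n)
    case 0
    \<comment> \<open>The second iterate is \<open>s\<^sup>2 + s = a\<^sup>2 - a\<close>.\<close>
    show ?case using d by (simp add: a_def numeral_2_eq_2 power2_eq_square algebra_simps)
  next
    case (Suc n)
    then show ?case using step[OF Suc] d by simp
  qed
  have "filterlim (\<lambda>n. critical_orbit s (n + 2)) at_top sequentially"
    by (rule increasing_by_at_least_tends_to_infinity[OF d]) (use step[OF large] in simp)
  then show ?thesis
    using filterlim_sequentially_Suc[of "critical_orbit s"]
      filterlim_sequentially_Suc[of "\<lambda>n. critical_orbit s (Suc n)"]
    by (simp del: funpow.simps)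
qed

lemma stretch_of_real_mult: "stretch K \<theta> (of_real x * u) = of_real x * stretch K \<theta> u"
  by (simp add: stretch_def algebra_simps)

lemma qr_quad_apply: "qr_quad K \<theta> c z = (stretch K \<theta> z)\<^sup>2 + c"
  by (simp add: qr_quad_def quad_def)

lemma qr_quad_orbit_on_invariant_line:
  assumes inv: "(stretch K \<theta> u)\<^sup>2 = of_real \<eta> * u" and "\<eta> \<noteq> 0"
  shows "(qr_quad K \<theta> (of_real t * u) ^^ n) 0 = of_real (critical_orbit (\<eta> * t) n / \<eta>) * u"
proof (induction n)
  case (Suc n)
  define y where "y = critical_orbit (\<eta> * t) n"
  have "(qr_quad K \<theta> (of_real t * u) ^^ Suc n) 0
      = (of_real (y / \<eta>) * stretch K \<theta> u)\<^sup>2 + of_real t * u"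
    by (simp only: funpow.simps o_apply Suc qr_quad_apply y_def stretch_of_real_mult)
  also have "\<dots> = of_real ((y / \<eta>)\<^sup>2 * \<eta> + t) * u"
    by (simp only: power_mult_distrib inv of_real_add of_real_mult of_real_power)
       (simp add: algebra_simps)
  also have "(y / \<eta>)\<^sup>2 * \<eta> + t = (y\<^sup>2 + \<eta> * t) / \<eta>"
    using \<open>\<eta> \<noteq> 0\<close> by (simp add: field_simps power2_eq_square)
  finally show ?case by (simp add: y_def)
qed simp

text \<open>The iterates have norm \<open>\<bar>y\<^sub>n\<bar> / \<eta>\<close> with \<open>y\<^sub>n\<close> the critical orbit for \<open>s = \<eta> t\<close>. As that orbit
  is either bounded or tends to infinity, membership is decided by \<open>s\<close>, although non-escape is in
  general weaker than boundedness.\<close>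

lemma invariant_line_mandelbrot_iff:
  assumes inv: "(stretch K \<theta> u)\<^sup>2 = of_real \<eta> * u" and "\<eta> > 0" and "norm u = 1"
  shows "of_real t * u \<in> mandelbrot K \<theta> \<longleftrightarrow> t \<in> {- 2 / \<eta> .. 1 / (4 * \<eta>)}"
proof -
  define s where "s = \<eta> * t"
  have norm_orbit: "norm ((qr_quad K \<theta> (of_real t * u) ^^ n) 0) = \<bar>critical_orbit s n\<bar> / \<eta>" for n
    using assms
    by (subst qr_quad_orbit_on_invariant_line[OF inv]) (simp_all add: norm_mult norm_divide s_def)
  have mem: "of_real t * u \<in> mandelbrot K \<theta> \<longleftrightarrow>
      \<not> filterlim (\<lambda>n. \<bar>critical_orbit s n\<bar> / \<eta>) at_top sequentially"
    by (simp add: mandelbrot_def escaping_set_def filterlim_at_infinity_conv_norm_at_top norm_orbit)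
  have "t \<in> {- 2 / \<eta> .. 1 / (4 * \<eta>)} \<longleftrightarrow> -2 \<le> s \<and> s \<le> 1/4"
    using \<open>\<eta> > 0\<close> by (auto simp: s_def field_simps)
  moreover have "\<not> filterlim (\<lambda>n. \<bar>critical_orbit s n\<bar> / \<eta>) at_top sequentially"
    if "-2 \<le> s" "s \<le> 1/4"
  proof
    assume "filterlim (\<lambda>n. \<bar>critical_orbit s n\<bar> / \<eta>) at_top sequentially"
    then have "\<forall>\<^sub>F n in sequentially. 2 / \<eta> < \<bar>critical_orbit s n\<bar> / \<eta>"
      by (simp add: filterlim_at_top_dense)
    then obtain n where "2 / \<eta> < \<bar>critical_orbit s n\<bar> / \<eta>"
      using eventually_happens sequentially_bot by blast
    then show False
      using critical_orbit_bounded[OF that, of n] \<open>\<eta> > 0\<close> by (simp add: divide_less_cancel)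
  qed
  moreover have "filterlim (\<lambda>n. \<bar>critical_orbit s n\<bar> / \<eta>) at_top sequentially"
    if "\<not> (-2 \<le> s \<and> s \<le> 1/4)"
  proof -
    have "filterlim (critical_orbit s) at_top sequentially"
      using that by (intro critical_orbit_escapes) auto
    then have "filterlim (\<lambda>n. \<bar>critical_orbit s n\<bar>) at_top sequentially"
      by (rule filterlim_at_top_mono) (intro always_eventually allI abs_ge_self)
    then have "filterlim (\<lambda>n. (1 / \<eta>) * \<bar>critical_orbit s n\<bar>) at_top sequentially"
      using \<open>\<eta> > 0\<close> by (intro filterlim_tendsto_pos_mult_at_top[OF tendsto_const]) auto
    then show ?thesis by simp
  qed
  ultimately show ?thesis using mem by blast
qed

text \<open>Writing \<open>u = v\<^sup>2\<close> removes the square from the condition \<open>(h u)\<^sup>2 = \<eta> u\<close>: it suffices that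
  \<open>h (v\<^sup>2) = r v\<close> with \<open>r\<close> real and nonzero, for then \<open>\<eta> = r\<^sup>2\<close>. With \<open>v = e\<^sup>i\<^sup>a\<close>, \<open>A = (K+1)/2\<close> and
  \<open>B = (K-1)/2\<close>, the quotient is \<open>h (v\<^sup>2) / v = A e\<^sup>i\<^sup>a + B e\<^sup>i\<^sup>(\<^sup>2\<^sup>\<theta>\<^sup>-\<^sup>3\<^sup>a\<^sup>)\<close>. Its imaginary part changes sign
  under \<open>a \<mapsto> a + \<pi>\<close>, hence vanishes for some \<open>a \<in> [0, \<pi>]\<close>, and \<open>r = 0\<close> is impossible because
  \<open>A\<^sup>2 - B\<^sup>2 = K\<close>.\<close>

lemma stretch_invariant_direction:
  assumes "K > 0"
  shows "\<exists>\<phi> \<in> {0 .. 2 * pi}. \<exists>\<eta>::real. \<eta> > 0 \<and> (stretch K \<theta> (cis \<phi>))\<^sup>2 = of_real \<eta> * cis \<phi>"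
proof -
  define A B where "A = (K + 1) / 2" and "B = (K - 1) / 2"
  define F where "F a = A * sin a + B * sin (2 * \<theta> - 3 * a)" for a
  have cont: "continuous_on {0..pi} F"
    unfolding F_def by (intro continuous_intros)
  have "sin (2 * \<theta> - 3 * pi) = - sin (2 * \<theta>)"
    using sin_periodic[of "2 * \<theta> - 3 * pi"] sin_minus_pi[of "2 * \<theta>"]
    by (simp add: algebra_simps del: sin_periodic sin_minus_pi)
  then have "F pi = - F 0" by (simp add: F_def)
  then obtain a where a: "0 \<le> a" "a \<le> pi" "F a = 0"
    using IVT'[of F 0 0 pi, OF _ _ _ cont] IVT2'[of F pi 0 0, OF _ _ _ cont]
    by (metis linear neg_0_le_iff_le neg_le_0_iff_le pi_ge_zero)
  define r where "r = A * cos a + B * cos (2 * \<theta> - 3 * a)"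
  have "r \<noteq> 0"
  proof
    assume "r = 0"
    then have "A * cos a = - (B * cos (2 * \<theta> - 3 * a))" "A * sin a = - (B * sin (2 * \<theta> - 3 * a))"
      using a(3) by (auto simp: r_def F_def)
    then have "(A * cos a)\<^sup>2 + (A * sin a)\<^sup>2
        = (B * cos (2 * \<theta> - 3 * a))\<^sup>2 + (B * sin (2 * \<theta> - 3 * a))\<^sup>2"
      by simp
    then have "A\<^sup>2 = B\<^sup>2"
      by (simp add: power_mult_distrib flip: distrib_left)
    then show False
      using assms by (simp add: A_def B_def power2_eq_square field_simps)
  qed
  have "stretch K \<theta> (cis (2 * a)) = of_real A * cis (2 * a) + of_real B * cis (2 * \<theta> - 2 * a)"
  proof -
    have "exp (2 * \<i> * of_real \<theta>) = cis (2 * \<theta>)" by (simp add: cis_conv_exp mult_ac)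
    then show ?thesis
      by (simp add: stretch_def A_def B_def cis_cnj cis_mult mult_ac)
  qed
  also have "\<dots> = (of_real A * cis a + of_real B * cis (2 * \<theta> - 3 * a)) * cis a"
    by (simp add: distrib_right mult.assoc cis_mult)
  also have "of_real A * cis a + of_real B * cis (2 * \<theta> - 3 * a) = of_real r"
    using a(3) by (simp add: complex_eq_iff r_def F_def)
  finally have "(stretch K \<theta> (cis (2 * a)))\<^sup>2 = of_real (r\<^sup>2) * cis (2 * a)"
    by (simp add: power_mult_distrib power2_eq_square cis_mult)
  moreover have "r\<^sup>2 > 0" "2 * a \<in> {0 .. 2 * pi}" using \<open>r \<noteq> 0\<close> a by auto
  ultimately show ?thesis by blast
qed

theorem theorem6p4:
  fixes K \<theta> :: real
  assumes "K > 0"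
    and "- pi / 4 < \<theta>" and "\<theta> \<le> pi / 4"
    and "of_real K * exp (\<i> * of_real \<theta>) \<in> param_set"
  shows "(\<theta> = 0 \<longrightarrow>
            mandelbrot K 0 \<inter> \<real> = complex_of_real ` {- 2 / K\<^sup>2 .. 1 / (4 * K\<^sup>2)}) \<and>
         (\<theta> \<noteq> 0 \<longrightarrow>
            (\<exists>\<phi>\<^sub>0 \<in> {0 .. 2 * pi}. \<exists>\<eta>::real. \<eta> > 0 \<and>
               {of_real t * exp (\<i> * of_real \<phi>\<^sub>0) | t. t \<in> {- 2 / \<eta> .. 1 / (4 * \<eta>)}}
                 \<subseteq> mandelbrot K \<theta>))"
proof (intro conjI impI)
  have "stretch K 0 1 = of_real K" by (simp add: stretch_def field_simps)
  then have "of_real t \<in> mandelbrot K 0 \<longleftrightarrow> t \<in> {- 2 / K\<^sup>2 .. 1 / (4 * K\<^sup>2)}" for t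
    using invariant_line_mandelbrot_iff[of K 0 1 "K\<^sup>2" t] \<open>K > 0\<close> by simp
  then show "mandelbrot K 0 \<inter> \<real> = complex_of_real ` {- 2 / K\<^sup>2 .. 1 / (4 * K\<^sup>2)}"
    unfolding Reals_def by blast
next
  obtain \<phi> \<eta> where "\<phi> \<in> {0 .. 2 * pi}" "\<eta> > 0"
    and inv: "(stretch K \<theta> (cis \<phi>))\<^sup>2 = of_real \<eta> * cis \<phi>"
    using stretch_invariant_direction[OF \<open>K > 0\<close>] by blast
  moreover have "{of_real t * exp (\<i> * of_real \<phi>) | t. t \<in> {- 2 / \<eta> .. 1 / (4 * \<eta>)}}
      \<subseteq> mandelbrot K \<theta>"
    using invariant_line_mandelbrot_iff[OF inv \<open>\<eta> > 0\<close> norm_cis]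
    unfolding cis_conv_exp by blast
  ultimately show "\<exists>\<phi>\<^sub>0 \<in> {0 .. 2 * pi}. \<exists>\<eta>::real. \<eta> > 0 \<and>
      {of_real t * exp (\<i> * of_real \<phi>\<^sub>0) | t. t \<in> {- 2 / \<eta> .. 1 / (4 * \<eta>)}} \<subseteq> mandelbrot K \<theta>"
    by blast
qed

end
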